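(* Let $R$ be a GCD domain, let $(K_n,\alpha)$ be an edge labeled complete graph on vertices $v_1,\dots,v_n$, and let $\{F_1,F_2,\dots,F_n\}\subset R_{(K_n,\alpha)}$. Then $\{F_1,F_2,\dots,F_n\}$ forms an $R$-module basis of $R_{(K_n,\alpha)}$ if and only if $\big| F_1 \ F_2 \ \cdots \ F_n \big| = r\cdot Q_{K_n}$ where $r\in R$ is a unit.
   Context: A GCD domain is an integral domain in which any two elements have a greatest common divisor. Gcds and lcms are defined up to units. $K_n$ is the complete graph with ordered vertex set $\{v_1,\dots,v_n\}$. For a finite graph $G$ with ordered vertices $v_1,\dots,v_n$, an edge labeling $\alpha$ assigns to each edge $uv$ a principal ideal of $R$; a generator is denoted $l_{uv}$ and is also called the edge label. A (generalized) spline on $(G,\alpha)$ is a tuple $F=(F(v_1),\dots,F(v_n))\in R^n$ such that $F(u)-F(v)\in\alpha(uv)$, i.e. $l_{uv}$ divides $F(u)-F(v)$, for every edge $uv\in E(G)$. The set $R_{(G,\alpha)}$ of all splines is an $R$-module under componentwise operations. A trail is a sequence of vertices and edges, each edge joining the consecutive vertices, in which no edge is repeated. For $i>1$, a zero trail of $v_i$ is a trail in $G$ starting at $v_i$ and ending at some $v_j$ with $j<i$. For a trail $p$, $(p)$ denotes the gcd of the labels of its edges. For $i\ge 2$, $\mathscr{L}_i$ is the lcm of the elements $(p)$ over all zero trails $p$ of $v_i$, and $\mathscr{L}_1=1$. Put $Q_G=\prod_{i=1}^n \mathscr{L}_i$. $\big| F_1 \ F_2 \ \cdots \ F_n \big|$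 is the determinant of the $n\times n$ matrix whose $k$-th column is $(F_k(v_n),\dots,F_k(v_2),F_k(v_1))^T$.
   Formalization: All edge labels are assumed nonzero; if some label is 0 then Q_{K_n}=0, and F_1=…=F_n=0 has determinant 0=1·Q_{K_n} without being a basis, so the equivalence fails as stated. *)

theory Defs
  imports "HOL-Library.Function_Algebras" "Jordan_Normal_Form.Determinant"
begin

text \<open>
  Throughout, the GCD domain is a type of sort \<open>{idom, ring_gcd}\<close>. Class \<open>ring_gcd\<close> only fixes one
  representative of each gcd and lcm (\<open>normalize\<close> picks a representative of every class of
  associates and is not required to be multiplicative), so every GCD domain can be equipped with
  this structure.

  The vertex \<open>v\<^sub>i\<close> of a graph on \<open>n\<close> ordered vertices is the number \<open>i \<in> {1..n}\<close>, and an
  undirected edge is the set of its two endpoints.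
\<close>

definition complete_edges :: "nat \<Rightarrow> nat set set" where
  "complete_edges n = {{u, v} | u v. u \<in> {1..n} \<and> v \<in> {1..n} \<and> u \<noteq> v}"

definition principal_ideal :: "'a::comm_ring_1 \<Rightarrow> 'a set" where
  "principal_ideal a = {r * a | r. True}"

text \<open>The edge labeling is \<open>\<alpha>\<close>; the function \<open>l\<close> is a choice of generators (the edge labels).\<close>

definition edge_labeling ::
    "nat set set \<Rightarrow> (nat set \<Rightarrow> 'a::comm_ring_1 set) \<Rightarrow> (nat set \<Rightarrow> 'a) \<Rightarrow> bool" where
  "edge_labeling E \<alpha> l \<longleftrightarrow> (\<forall>e\<in>E. \<alpha> e = principal_ideal (l e))"

text \<open>
  The tuple \<open>(F(v\<^sub>1), \<dots>, F(v\<^sub>n)) \<in> R\<^sup>n\<close> is encoded as a function on \<open>nat\<close> that vanishes outside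
  \<open>{1..n}\<close>, so that these functions form a module isomorphic to \<open>R\<^sup>n\<close>.
\<close>

definition splines ::
    "nat \<Rightarrow> nat set set \<Rightarrow> (nat set \<Rightarrow> 'a::comm_ring_1 set) \<Rightarrow> (nat \<Rightarrow> 'a) set" where
  "splines n E \<alpha> =
     {F. (\<forall>v. v \<notin> {1..n} \<longrightarrow> F v = 0) \<and> (\<forall>u v. {u, v} \<in> E \<longrightarrow> F u - F v \<in> \<alpha> {u, v})}"

definition fun_scale :: "'a::comm_ring_1 \<Rightarrow> (nat \<Rightarrow> 'a) \<Rightarrow> nat \<Rightarrow> 'a" where
  "fun_scale c F = (\<lambda>v. c * F v)"

lemma module_fun_scale: "Modules.module fun_scale"
  by unfold_locales (simp_all add: fun_scale_def fun_eq_iff algebra_simps)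

lemma subspace_splines:
  assumes "edge_labeling E \<alpha> l"
  shows "Modules.module.subspace fun_scale (splines n E \<alpha>)"
proof -
  have *: "x \<in> \<alpha> e \<longleftrightarrow> l e dvd x" if "e \<in> E" for x e
    using assms that by (auto simp: edge_labeling_def principal_ideal_def dvd_def mult.commute)
  have "l e dvd (a + b) - (c + d)" if "l e dvd a - c" "l e dvd b - d" for e a b c d
    using dvd_add[OF that] by (simp add: algebra_simps)
  moreover have "l e dvd k * a - k * b" if "l e dvd a - b" for e k a b
    using dvd_mult[OF that, of k] by (simp add: algebra_simps)
  ultimately show ?thesis
    by (auto simp: Modules.module.subspace_def[OF module_fun_scale] splines_def fun_scale_def *)
qed

definition module_basis :: "(nat \<Rightarrow> 'a::comm_ring_1) set \<Rightarrow> (nat \<Rightarrow> 'a) set \<Rightarrow> bool" where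
  "module_basis B M \<longleftrightarrow>
     B \<subseteq> M \<and> \<not> Modules.module.dependent fun_scale B \<and> Modules.module.span fun_scale B = M"

text \<open>
  As edges are determined by their endpoints, a trail is given by its list of vertices.
\<close>

definition trail_edges :: "nat list \<Rightarrow> nat set list" where
  "trail_edges p = map2 (\<lambda>u v. {u, v}) p (tl p)"

definition trail :: "nat set set \<Rightarrow> nat list \<Rightarrow> bool" where
  "trail E p \<longleftrightarrow> p \<noteq> [] \<and> set (trail_edges p) \<subseteq> E \<and> distinct (trail_edges p)"

definition zero_trails :: "nat set set \<Rightarrow> nat \<Rightarrow> nat list set" where
  "zero_trails E i = {p. trail E p \<and> hd p = i \<and> last p \<in> {1..<i}}"

definition trail_gcd :: "(nat set \<Rightarrow> 'a::ring_gcd) \<Rightarrow> nat list \<Rightarrow> 'a" where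
  "trail_gcd l p = gcd_list (map l (trail_edges p))"

text \<open>
  The library's \<open>Lcm\<^sub>f\<^sub>i\<^sub>n\<close> is by convention \<open>0\<close> on infinite sets; this case does not arise for finite
  graphs, see \<open>finite_zero_trails\<close> below.
\<close>

definition trail_lcm :: "nat set set \<Rightarrow> (nat set \<Rightarrow> 'a::ring_gcd) \<Rightarrow> nat \<Rightarrow> 'a" where
  "trail_lcm E l i = (if i = 1 then 1 else Lcm\<^sub>f\<^sub>i\<^sub>n (trail_gcd l ` zero_trails E i))"

definition Q_graph :: "nat \<Rightarrow> nat set set \<Rightarrow> (nat set \<Rightarrow> 'a::ring_gcd) \<Rightarrow> 'a" where
  "Q_graph n E l = (\<Prod>i\<in>{1..n}. trail_lcm E l i)"

text \<open>
  Matrix indices start at \<open>0\<close>, so column \<open>k\<close> holds \<open>F\<^bsub>k+1\<^esub>\<close>, and row \<open>r\<close> holds the values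
  at \<open>v\<^bsub>n-r\<^esub>\<close>, i.e. at \<open>v\<^sub>n, \<dots>, v\<^sub>1\<close> from top to bottom.
\<close>

definition spline_matrix :: "nat \<Rightarrow> (nat \<Rightarrow> nat \<Rightarrow> 'a) \<Rightarrow> 'a mat" where
  "spline_matrix n F = mat n n (\<lambda>(r, k). F (k + 1) (n - r))"

lemma finite_zero_trails:
  assumes "finite E" "\<forall>e\<in>E. finite e"
  shows "finite (zero_trails E i)"
proof -
  have *: "set p \<subseteq> insert (hd p) (\<Union> (set (trail_edges p)))" for p
  proof
    fix x assume "x \<in> set p"
    then obtain k where k: "k < length p" "x = p ! k" by (auto simp: in_set_conv_nth)
    show "x \<in> insert (hd p) (\<Union> (set (trail_edges p)))"
    proof (cases k)
      case 0
      with k show ?thesis by (cases p) auto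
    next
      case (Suc j)
      with k have "j < length (trail_edges p)" "x \<in> trail_edges p ! j"
        by (auto simp: trail_edges_def nth_tl)
      then show ?thesis by (meson UnionI insertI2 nth_mem)
    qed
  qed
  have "zero_trails E i \<subseteq> {p. set p \<subseteq> insert i (\<Union> E) \<and> length p \<le> card E + 1}"
  proof
    fix p assume p: "p \<in> zero_trails E i"
    then have E: "set (trail_edges p) \<subseteq> E" and d: "distinct (trail_edges p)" and "hd p = i"
      by (auto simp: zero_trails_def trail_def)
    have "length (trail_edges p) \<le> card E"
      using distinct_card[OF d] card_mono[OF assms(1) E] by simp
    then have "length p \<le> card E + 1" by (simp add: trail_edges_def)
    with *[of p] E \<open>hd p = i\<close>
    show "p \<in> {p. set p \<subseteq> insert i (\<Union> E) \<and> length p \<le> card E + 1}" by blast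
  qed
  moreover have "finite {p. set p \<subseteq> insert i (\<Union> E) \<and> length p \<le> card E + 1}"
    using assms by (intro finite_lists_length_le) auto
  ultimately show ?thesis by (rule finite_subset)
qed

lemma finite_complete_edges: "finite (complete_edges n)" "\<forall>e\<in>complete_edges n. finite e"
proof -
  have "complete_edges n \<subseteq> Pow {1..n}" by (auto simp: complete_edges_def)
  then show "finite (complete_edges n)" by (rule finite_subset) simp
qed (auto simp: complete_edges_def)

end

theory Submission
  imports Defs
begin

text \<open>
  Divisibility in a GCD domain can be tested in localizations whose divisibility preorder is total
  (valuation rings), so gcds and lcms of finite families are attained there. In such a localization,
  \<open>\<L>\<^sub>i\<close> divides \<open>F(v\<^sub>i) - F(v\<^sub>j)\<close> for all splines \<open>F\<close> and a suitable \<open>j < i\<close>, namely the end of a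
  zero trail attaining the lcm; by row operations \<open>Q\<close> divides every determinant of \<open>n\<close> splines.
  Conversely \<open>Q\<close> is itself, locally, such a determinant: the function that is \<open>\<L>\<^sub>i\<close> on the vertices
  reachable from \<open>v\<^sub>i\<close> by edges whose labels do not divide \<open>\<L>\<^sub>i\<close>, and \<open>0\<close> elsewhere, is a spline that
  vanishes at all \<open>v\<^sub>j\<close> with \<open>j < i\<close>.

  If the \<open>F\<^sub>k\<close> form a basis, their determinant divides all determinants of \<open>n\<close> splines, hence \<open>Q\<close>. If
  their determinant is \<open>Q\<close> up to a unit, it divides all those determinants, and Cramer's rule expresses every
  spline in terms of the \<open>F\<^sub>k\<close>.
\<close>

section \<open>Localizations with total divisibility\<close>

text \<open>
  \<open>S\<close> is the set of denominators; the last condition makes divisibility total in the localization.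
\<close>

locale total_localization =
  fixes S :: "'a::{idom, ring_gcd} set"
  assumes one_mem: "1 \<in> S"
    and mult_mem: "a \<in> S \<Longrightarrow> b \<in> S \<Longrightarrow> a * b \<in> S"
    and coprime_mem: "coprime a b \<Longrightarrow> a \<in> S \<or> b \<in> S"
begin

text \<open>Divisibility in the localization at \<open>S\<close>, with denominators cleared so that
  all elements stay in the domain.\<close>

definition local_dvd :: "'a \<Rightarrow> 'a \<Rightarrow> bool"  (infix "\<preceq>" 50) where
  "a \<preceq> b \<longleftrightarrow> (\<exists>s\<in>S. a dvd s * b)"

lemma dvd_imp_local_dvd: "a dvd b \<Longrightarrow> a \<preceq> b"
  using one_mem by (auto simp: local_dvd_def)

lemma local_dvd_trans [trans]: "a \<preceq> b \<Longrightarrow> b \<preceq> c \<Longrightarrow> a \<preceq> c"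
proof -
  assume "a \<preceq> b" "b \<preceq> c"
  then obtain s t where st: "s \<in> S" "a dvd s * b" "t \<in> S" "b dvd t * c"
    by (auto simp: local_dvd_def)
  then have "a dvd (s * t) * c"
    using dvd_trans[of a "s * b" "s * (t * c)"] by (simp add: mult.assoc)
  with st show "a \<preceq> c" by (auto simp: local_dvd_def intro: mult_mem)
qed

text \<open>Dividing by the gcd leaves coprime cofactors \<open>a'\<close> and \<open>b'\<close>.
  One of them is a denominator, and \<open>a' * b = b' * a\<close> is a multiple of both
  \<open>a\<close> and \<open>b\<close>.\<close>

lemma local_dvd_total: "a \<preceq> b \<or> b \<preceq> a"
proof (cases "a = 0 \<and> b = 0")
  case True
  then show ?thesis by (simp add: dvd_imp_local_dvd)
next
  case False
  then obtain a' b' where *: "a = a' * gcd a b" "b = b' * gcd a b" "coprime a' b'"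
    using gcd_coprime_exists[of a b] by auto
  have "a dvd a' * b" "b dvd b' * a"
    by (metis * dvd_triv_left mult.assoc mult.commute mult.left_commute)+
  with coprime_mem[OF *(3)] show ?thesis by (auto simp: local_dvd_def)
qed

lemma prod_mem: "(\<And>i. i \<in> I \<Longrightarrow> f i \<in> S) \<Longrightarrow> prod f I \<in> S"
  by (induction I rule: infinite_finite_induct) (auto intro: one_mem mult_mem)

lemma Lcm_fin_local_dvd:
  assumes "finite A" "\<And>a. a \<in> A \<Longrightarrow> a \<preceq> b"
  shows "Lcm\<^sub>f\<^sub>i\<^sub>n A \<preceq> b"
  using assms
proof (induction A)
  case empty
  then show ?case by (simp add: dvd_imp_local_dvd)
next
  case (insert a A)
  then have "a \<preceq> b" "Lcm\<^sub>f\<^sub>i\<^sub>n A \<preceq> b" by auto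
  then obtain s t where st: "s \<in> S" "a dvd s * b" "t \<in> S" "Lcm\<^sub>f\<^sub>i\<^sub>n A dvd t * b"
    by (auto simp: local_dvd_def)
  have "lcm a (Lcm\<^sub>f\<^sub>i\<^sub>n A) dvd (s * t) * b"
    using dvd_mult[OF st(2), of t] dvd_mult[OF st(4), of s] by (intro lcm_least) (simp_all add: ac_simps)
  with st show ?case by (auto simp: local_dvd_def intro: mult_mem)
qed

text \<open>Local divisibility is a total preorder, so the set has a largest element, and the lcm
  locally divides every common upper bound.\<close>

lemma Lcm_fin_attained:
  assumes "finite A" "A \<noteq> {}"
  obtains a where "a \<in> A" "Lcm\<^sub>f\<^sub>i\<^sub>n A \<preceq> a"
proof -
  have "\<exists>a\<in>A. \<forall>b\<in>A. b \<preceq> a"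
    using assms
  proof (induction A rule: finite_ne_induct)
    case (singleton a)
    then show ?case by (simp add: dvd_imp_local_dvd)
  next
    case (insert c A)
    then obtain a where "a \<in> A" "\<forall>b\<in>A. b \<preceq> a" by auto
    then show ?case
      using local_dvd_total[of a c] by (auto intro: local_dvd_trans dvd_imp_local_dvd)
  qed
  with that show ?thesis using Lcm_fin_local_dvd[OF assms(1)] by blast
qed

text \<open>A least entry locally divides the gcd of all entries, since a common denominator factors
  out of a gcd.\<close>

lemma gcd_list_attained:
  assumes "xs \<noteq> []"
  obtains x where "x \<in> set xs" "x \<preceq> gcd_list xs"
proof -
  have "\<exists>x\<in>set xs. x \<preceq> gcd_list xs"
    using assms
  proof (induction xs rule: list_nonempty_induct)
    case (single x)
    then show ?case by (simp add: dvd_imp_local_dvd)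
  next
    case (cons a xs)
    then obtain x where x: "x \<in> set xs" "x \<preceq> gcd_list xs" by auto
    have gcdI: "z \<preceq> gcd a (gcd_list xs)" if "z \<preceq> a" and "z \<preceq> gcd_list xs" for z
    proof -
      from that obtain s t where st: "s \<in> S" "z dvd s * a" "t \<in> S" "z dvd t * gcd_list xs"
        by (auto simp: local_dvd_def)
      have "z dvd gcd ((s * t) * a) ((s * t) * gcd_list xs)"
        using dvd_mult[OF st(2), of t] dvd_mult[OF st(4), of s] 
        by (intro gcd_greatest) (simp_all add: ac_simps)
      then have "z dvd (s * t) * gcd a (gcd_list xs)" by (simp add: gcd_mult_left)
      with st show ?thesis by (auto simp: local_dvd_def intro: mult_mem)
    qed
    from local_dvd_total[of a x] show ?case
    proof
      assume "a \<preceq> x"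
      then show ?thesis 
        using gcdI[of a] x local_dvd_trans[of a x] by (auto simp: dvd_imp_local_dvd)
    next
      assume "x \<preceq> a"
      then show ?thesis using gcdI[of x] x by auto
    qed
  qed
  with that show ?thesis by blast
qed

end

text \<open>
  Zorn's lemma yields a maximal set of denominators for which \<open>x\<close> does not divide \<open>y\<close>. If it could be enlarged
  neither by \<open>a\<close> nor by \<open>b\<close>, with \<open>a\<close> and \<open>b\<close> coprime, then \<open>x\<close> would divide \<open>s * t * y * a ^ k\<close> and
  \<open>s * t * y * b ^ m\<close>, hence \<open>s * t * y\<close>.
\<close>

lemma dvd_if_locally_dvd:
  fixes x y :: "'a::{idom, ring_gcd}"
  assumes local: "\<And>S. total_localization S \<Longrightarrow> total_localization.local_dvd S x y"
  shows "x dvd y"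
proof (rule ccontr)
  assume ndvd: "\<not> x dvd y"
  define \<A> where "\<A> = {S. 1 \<in> S \<and> (\<forall>a\<in>S. \<forall>b\<in>S. a * b \<in> S) \<and> (\<forall>s\<in>S. \<not> x dvd s * y)}"
  have "{1} \<in> \<A>" using ndvd by (simp add: \<A>_def)
  moreover have "\<Union>\<C> \<in> \<A>" if "\<C> \<noteq> {}" "subset.chain \<A> \<C>" for \<C>
  proof -
    have sub: "\<C> \<subseteq> \<A>" and cmp: "\<And>X Y. X \<in> \<C> \<Longrightarrow> Y \<in> \<C> \<Longrightarrow> X \<subseteq> Y \<or> Y \<subseteq> X"
      using that by (auto simp: subset.chain_def subset_chain_def)
    have "a * b \<in> \<Union>\<C>" if "a \<in> \<Union>\<C>" "b \<in> \<Union>\<C>" for a b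
    proof -
      from that obtain X Y where XY: "X \<in> \<C>" "Y \<in> \<C>" "a \<in> X" "b \<in> Y" by auto
      then obtain Z where "Z \<in> \<C>" "a \<in> Z" "b \<in> Z" using cmp[of X Y] by blast
      then show ?thesis using sub by (auto simp: \<A>_def)
    qed
    then show ?thesis using that(1) sub by (fastforce simp: \<A>_def)
  qed
  ultimately obtain S where S: "S \<in> \<A>" and max: "\<And>T. T \<in> \<A> \<Longrightarrow> S \<subseteq> T \<Longrightarrow> T = S"
    using subset_Zorn_nonempty[of \<A>] by (metis empty_iff)
  from S have one: "1 \<in> S" and mult: "\<And>a b. a \<in> S \<Longrightarrow> b \<in> S \<Longrightarrow> a * b \<in> S"
    and avoid: "\<And>s. s \<in> S \<Longrightarrow> \<not> x dvd s * y" by (auto simp: \<A>_def)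
  have extend: "\<exists>s\<in>S. \<exists>k. x dvd s * a ^ k * y" if "a \<notin> S" for a
  proof (rule ccontr)
    assume no: "\<not> ?thesis"
    \<comment> \<open>The multiplicative set generated by \<open>S\<close> and \<open>a\<close>; it
      would contradict the maximality of \<open>S\<close>.\<close>
    define T where "T = {s * a ^ k | s k. s \<in> S}"
    have "s * a ^ k * (t * a ^ m) \<in> T" if "s \<in> S" "t \<in> S" for s t k m
      unfolding T_def using mult[OF that] 
      by (auto intro!: exI[of _ "s * t"] exI[of _ "k + m"] simp: power_add)
    moreover have "S \<subseteq> T" "a \<in> T"
      unfolding T_def using one by (auto intro: exI[of _ "0::nat"] exI[of _ "1::nat"] exI[of _ "1::'a"])
         (metis mult.right_neutral power_0, metis mult_1 power_one_right)
    moreover have "\<not> x dvd u * y" if "u \<in> T" for u using no that by (auto simp: T_def)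
    ultimately have "T \<in> \<A>" using one unfolding \<A>_def by (fastforce simp: T_def)
    with max \<open>S \<subseteq> T\<close> \<open>a \<in> T\<close> that show False by blast
  qed
  have "a \<in> S \<or> b \<in> S" if "coprime a b" for a b
  proof (rule ccontr)
    assume "\<not> ?thesis"
    with extend obtain s k t m 
      where st: "s \<in> S" "x dvd s * a ^ k * y" "t \<in> S" "x dvd t * b ^ m * y" by metis
    have "x dvd gcd ((s * t * y) * a ^ k) ((s * t * y) * b ^ m)"
      using dvd_mult[OF st(2), of t] dvd_mult[OF st(4), of s] 
      by (intro gcd_greatest) (simp_all add: ac_simps)
    also have "\<dots> = normalize (s * t * y)"
      using that by (simp add: gcd_mult_left coprime_iff_gcd_eq_1 flip: coprime_iff_gcd_eq_1)
    finally show False using avoid[OF mult[OF st(1,3)]] by simp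
  qed
  with one mult interpret total_localization S by unfold_locales auto
  show False using local[OF total_localization_axioms] avoid by (auto simp: local_dvd_def)
qed

section \<open>Splines and trails\<close>

lemma trail_edges_simps [simp]:
  "trail_edges [u] = []"
  "trail_edges (u # v # p) = {u, v} # trail_edges (v # p)"
  by (simp_all add: trail_edges_def)

lemma trail_edges_subset: "e \<in> set (trail_edges p) \<Longrightarrow> e \<subseteq> set p"
  by (induction p rule: induct_list012) (auto simp: trail_edges_def)

text \<open>The first edge contains the first vertex, which does not recur. Hence paths are
  trails.\<close>

lemma distinct_trail_edges: "distinct p \<Longrightarrow> distinct (trail_edges p)"
proof (induction p rule: induct_list012)
  case (3 u v p)
  then show ?case using trail_edges_subset[of "{u, v}" "v # p"] by auto
qed (simp_all add: trail_edges_def)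

lemma set_trail_edges_subset_iff:
  "set (trail_edges p) \<subseteq> A \<longleftrightarrow> successively (\<lambda>u v. {u, v} \<in> A) p"
  by (induction p rule: induct_list012) (auto simp: trail_edges_def)

lemma path_exists:
  assumes "(\<lambda>u v. {u, v} \<in> A)\<^sup>*\<^sup>* u v"
  obtains p where "p \<noteq> []" "hd p = u" "last p = v" "distinct p" "set (trail_edges p) \<subseteq> A"
proof -
  from assms have "\<exists>p. p \<noteq> [] \<and> hd p = u \<and> last p = v \<and> distinct p \<and> set (trail_edges p) \<subseteq> A"
  proof (induction rule: rtranclp_induct)
    case base
    show ?case by (intro exI[of _ "[u]"]) simp
  next
    case (step v w)
    then obtain p where p: "p \<noteq> []" "hd p = u" "last p = v" "distinct p" "set (trail_edges p) \<subseteq> A"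
      by auto
    show ?case
    proof (cases "w \<in> set p")
      case True
      \<comment> \<open>A walk that returns to an earlier vertex is cut there, which keeps the
        vertices distinct.\<close>
      then obtain q r where "p = q @ w # r" by (meson split_list)
      with p show ?thesis
        by (intro exI[of _ "q @ [w]"])
           (auto simp: set_trail_edges_subset_iff successively_append_iff hd_append)
    next
      case False
      with p step.hyps(2) show ?thesis
        by (intro exI[of _ "p @ [w]"])
           (auto simp: set_trail_edges_subset_iff successively_append_iff)
    qed
  qed
  with that show ?thesis by blast
qed

lemma spline_edge_dvd:
  assumes "edge_labeling E \<alpha> l" "G \<in> splines n E \<alpha>" "{u, v} \<in> E"
  shows "l {u, v} dvd G u - G v"
  using assms by (force simp: edge_labeling_def principal_ideal_def splines_def)

lemma splinesI:
  assumes "edge_labeling E \<alpha> l" "\<And>v. v \<notin> {1..n} \<Longrightarrow> G v = 0"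
    and "\<And>u v. {u, v} \<in> E \<Longrightarrow> l {u, v} dvd G u - G v"
  shows "G \<in> splines n E \<alpha>"
  using assms by (force simp: edge_labeling_def principal_ideal_def splines_def dvd_def mult.commute)

text \<open>The difference telescopes along \<open>p\<close>, and each summand is divisible by an
  edge label.\<close>

lemma trail_gcd_dvd_spline_diff:
  assumes "edge_labeling E \<alpha> l" "G \<in> splines n E \<alpha>" "p \<noteq> []" "set (trail_edges p) \<subseteq> E"
  shows "trail_gcd l p dvd G (hd p) - G (last p)"
  using assms(3,4)
proof (induction p rule: induct_list012)
  case (3 u v p)
  have "trail_gcd l (u # v # p) dvd G u - G v"
    using spline_edge_dvd[OF assms(1,2), of u v] 3(4) 
    by (auto simp: trail_gcd_def intro: dvd_trans[OF gcd_dvd1])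
  moreover have "trail_gcd l (u # v # p) dvd G v - G (last (v # p))"
    using 3(2,4) by (auto simp: trail_gcd_def intro: dvd_trans[OF gcd_dvd2])
  ultimately have "trail_gcd l (u # v # p) dvd (G u - G v) + (G v - G (last (v # p)))"
    by (rule dvd_add)
  then show ?case by simp
qed simp_all

section \<open>Trails and splines in a localization\<close>

context total_localization
begin

text \<open>Neither \<open>s\<close> nor \<open>j\<close> depends on \<open>G\<close>, so one row
  operation serves all columns of a determinant.\<close>

lemma spline_diff_local_dvd:
  assumes lab: "edge_labeling E \<alpha> l" and E: "finite E" "\<forall>e\<in>E. finite e" and "i > 0"
  obtains s j where "s \<in> S" "j < i" 
    "\<And>G. G \<in> splines n E \<alpha> \<Longrightarrow> trail_lcm E l i dvd s * (G i - G j)"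
proof (cases "i = 1 \<or> zero_trails E i = {}")
  case True
  \<comment> \<open>The lcm of the empty set is 1, so any \<open>j\<close> below \<open>i\<close>
    works with denominator 1.\<close>
  then have "trail_lcm E l i = 1" by (auto simp: trail_lcm_def)
  with one_mem \<open>i > 0\<close> that show ?thesis by auto
next
  case False
  with finite_zero_trails[OF E] obtain p where p: "p \<in> zero_trails E i"
    "Lcm\<^sub>f\<^sub>i\<^sub>n (trail_gcd l ` zero_trails E i) \<preceq> trail_gcd l p"
    using Lcm_fin_attained[of "trail_gcd l ` zero_trails E i"] by auto
  then obtain s where s: "s \<in> S" "trail_lcm E l i dvd s * trail_gcd l p"
    using False by (auto simp: trail_lcm_def local_dvd_def)
  have "trail_lcm E l i dvd s * (G i - G (last p))" if "G \<in> splines n E \<alpha>" for G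
    using p(1) s(2) trail_gcd_dvd_spline_diff[OF lab that, where p = p]
    by (auto simp: zero_trails_def trail_def intro: dvd_trans)
  with that[of s "last p"] s(1) p(1) show ?thesis by (auto simp: zero_trails_def)
qed

text \<open>Edges in \<open>A\<close> join vertices of equal value; all other labels locally divide
  the lcm. Vanishing below \<open>i\<close> will make the matrix of such splines triangular.\<close>

lemma flow_up_spline:
  assumes lab: "edge_labeling E \<alpha> l" and E: "finite E" "\<And>e. e \<in> E \<Longrightarrow> e \<subseteq> {1..n}" and "i \<in> {1..n}"
  obtains G s where "s \<in> S" "G \<in> splines n E \<alpha>" "G i = s * trail_lcm E l i" "\<And>j. j < i \<Longrightarrow> G j = 0"
proof -
  define L where "L = trail_lcm E l i"
  define A where "A = {e \<in> E. \<not> l e \<preceq> L}"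
  define C where "C = {v. (\<lambda>u v. {u, v} \<in> A)\<^sup>*\<^sup>* i v}"
  have fin: "\<forall>e\<in>E. finite e" using E(2) finite_subset by blast
  have C_step: "v \<in> C" if "u \<in> C" "{u, v} \<in> A" for u v
    using that unfolding C_def mem_Collect_eq by (rule rtranclp.rtrancl_into_rtrancl)
  have C_range: "v \<in> {1..n}" if "v \<in> C" for v
    using that[unfolded C_def mem_Collect_eq]
  proof (cases rule: rtranclp.cases)
    case (rtrancl_into_rtrancl u)
    with E(2)[of "{u, v}"] show ?thesis by (auto simp: A_def)
  qed (use assms(4) in simp)
  \<comment> \<open>Otherwise \<open>v\<^sub>i\<close> has a zero trail all of whose labels fail to divide \<open>L\<close>, but one of them
    divides the gcd of the trail, which divides \<open>L\<close>.\<close>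
  have C_below: "j \<notin> C" if "j < i" for j
  proof
    assume "j \<in> C"
    then obtain p where p: "p \<noteq> []" "hd p = i" "last p = j" "distinct p" "set (trail_edges p) \<subseteq> A"
      unfolding C_def mem_Collect_eq by (rule path_exists)
    have "j \<in> {1..<i}" using C_range[OF \<open>j \<in> C\<close>] that by simp
    then have "p \<in> zero_trails E i" and "i \<noteq> 1"
      using p by (auto simp: zero_trails_def trail_def distinct_trail_edges A_def)
    have "trail_edges p \<noteq> []" using p(1-3) that by (cases p rule: remdups_adj.cases) auto
    then obtain e where e: "e \<in> set (trail_edges p)" "l e \<preceq> trail_gcd l p"
      using gcd_list_attained[of "map l (trail_edges p)"] by (auto simp: trail_gcd_def)
    have "trail_gcd l p dvd L"
      unfolding L_def trail_lcm_def using \<open>i \<noteq> 1\<close> \<open>p \<in> zero_trails E i\<close> by (auto intro: dvd_Lcm_fin)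
    then have "trail_gcd l p \<preceq> L" by (rule dvd_imp_local_dvd)
    with e(2) have "l e \<preceq> L" by (rule local_dvd_trans)
    with e(1) p(5) show False by (auto simp: A_def)
  qed
  have "\<forall>e\<in>E - A. \<exists>s\<in>S. l e dvd s * L" by (auto simp: A_def local_dvd_def)
  then obtain t where t: "\<forall>e\<in>E - A. t e \<in> S \<and> l e dvd t e * L" unfolding bchoice_iff Bex_def by blast
  \<comment> \<open>A common denominator for the finitely many edges outside
    \<open>A\<close>.\<close>
  define s where "s = prod t (E - A)"
  have sdvd: "l e dvd s * L" if "e \<in> E - A" for e
  proof -
    have "t e dvd s" unfolding s_def using that E(1) by (intro dvd_prodI) auto
    then have "t e * L dvd s * L" by (rule mult_dvd_mono) simp
    with t that show ?thesis using dvd_trans by blast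
  qed
  define G where "G v = (if v \<in> C then s * L else 0)" for v
  have "G \<in> splines n E \<alpha>"
  proof (rule splinesI[OF lab])
    fix u v assume uv: "{u, v} \<in> E"
    show "l {u, v} dvd G u - G v"
    proof (cases "{u, v} \<in> A")
      case True
      moreover from this have "{v, u} \<in> A" by (simp add: insert_commute)
      ultimately have "u \<in> C \<longleftrightarrow> v \<in> C" using C_step by blast
      then show ?thesis by (auto simp: G_def)
    next
      case False
      with uv sdvd show ?thesis by (auto simp: G_def)
    qed
  qed (use C_range in \<open>auto simp: G_def\<close>)
  moreover have "s \<in> S" unfolding s_def using t by (intro prod_mem) auto
  moreover have "G i = s * trail_lcm E l i" by (simp add: G_def C_def L_def)
  moreover have "G j = 0" if "j < i" for j using C_below[OF that] by (simp add: G_def)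
  ultimately show ?thesis by (intro that[of s G])
qed

end

section \<open>Determinants of splines\<close>

interpretation fun_module: Modules.module fun_scale
  by (rule module_fun_scale)

section \<open>Linear combinations and matrix products\<close>

lemma fun_scale_apply: "fun_scale c F v = c * F v"
  by (simp add: fun_scale_def)

lemma sum_fun_scale_apply: "(\<Sum>i\<in>I. fun_scale (c i) (F i)) v = (\<Sum>i\<in>I. c i * F i v)"
  by (induction I rule: infinite_finite_induct) (simp_all add: fun_scale_apply)

text \<open>Coefficients belong to indices rather than vectors, so that \<open>F\<close> may repeat
  a vector and the coefficients can serve as matrix entries.\<close>

lemma span_image_iff:
  assumes "finite I"
  shows "x \<in> fun_module.span (F ` I) \<longleftrightarrow> (\<exists>c. x = (\<Sum>i\<in>I. fun_scale (c i) (F i)))"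
proof
  assume "x \<in> fun_module.span (F ` I)"
  then show "\<exists>c. x = (\<Sum>i\<in>I. fun_scale (c i) (F i))"
  proof (induction rule: fun_module.span_induct_alt)
    case base
    show ?case by (intro exI[of _ "\<lambda>_. 0"]) (simp add: fun_scale_def fun_eq_iff sum_fun_scale_apply)
  next
    case (step a x y)
    then obtain c i where c: "y = (\<Sum>i\<in>I. fun_scale (c i) (F i))" and i: "i \<in> I" "x = F i" by auto
    have "fun_scale a x + y = (\<Sum>j\<in>I. fun_scale (c j + (if j = i then a else 0)) (F j))"
      using assms i(1) unfolding c i(2)
      by (intro ext) (simp add: sum_fun_scale_apply distrib_right sum.distrib if_distrib[of "\<lambda>r. r * _"]
          fun_scale_apply cong: if_cong)
    then show ?case by (intro exI[of _ "\<lambda>j. c j + (if j = i then a else 0)"])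
  qed
qed (auto intro!: fun_module.span_sum fun_module.span_scale intro: fun_module.span_base)

lemma spline_matrix_carrier [simp]: "spline_matrix n F \<in> carrier_mat n n"
  by (simp add: spline_matrix_def)

lemma spline_matrix_mult:
  "spline_matrix n F * mat n n (\<lambda>(i, k). c (k + 1) (i + 1)) =
     spline_matrix n (\<lambda>k. \<Sum>i\<in>{1..n}. fun_scale (c k i) (F i))"
  by (rule eq_matI)
     (auto simp: spline_matrix_def scalar_prod_def sum_fun_scale_apply sum.atLeast1_atMost_eq
        lessThan_atLeast0 mult.commute)

lemma spline_matrix_mult_vec:
  "spline_matrix n F *\<^sub>v vec n (\<lambda>k. c (k + 1)) = vec n (\<lambda>r. (\<Sum>i\<in>{1..n}. fun_scale (c i) (F i)) (n - r))"
  by (rule eq_vecI)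
     (auto simp: spline_matrix_def scalar_prod_def sum_fun_scale_apply sum.atLeast1_atMost_eq
        lessThan_atLeast0 mult.commute)

lemma independent_if_det_nonzero:
  fixes F :: "nat \<Rightarrow> nat \<Rightarrow> 'a::idom"
  assumes "det (spline_matrix n F) \<noteq> 0"
  shows "fun_module.independent (F ` {1..n})"
proof
  \<comment> \<open>Dependence concerns the set of vectors; injectivity turns a relation on the set
    into one on the indices.\<close>
  have inj: "inj_on F {1..n}"
  proof (rule inj_onI, rule ccontr)
    fix i j assume ij: "i \<in> {1..n}" "j \<in> {1..n}" "F i = F j" "i \<noteq> j"
    then have "col (spline_matrix n F) (i - 1) = col (spline_matrix n F) (j - 1)"
      by (auto simp: spline_matrix_def)
    then have "det (spline_matrix n F) = 0"
      using ij by (intro det_identical_columns[of _ n "i - 1" "j - 1"]) auto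
    with assms show False by contradiction
  qed
  assume "fun_module.dependent (F ` {1..n})"
  then obtain u i where u: "(\<Sum>v\<in>F ` {1..n}. fun_scale (u v) v) = 0" "i \<in> {1..n}" "u (F i) \<noteq> 0"
    by (auto simp: fun_module.dependent_finite)
  have "(\<Sum>i\<in>{1..n}. fun_scale (u (F i)) (F i)) = 0"
    using u(1) sum.reindex[OF inj, of "\<lambda>v. fun_scale (u v) v"] by (simp add: o_def)
  then have "spline_matrix n F *\<^sub>v vec n (\<lambda>k. u (F (k + 1))) = 0\<^sub>v n"
    by (subst spline_matrix_mult_vec) auto
  moreover have "vec n (\<lambda>k. u (F (k + 1))) \<noteq> 0\<^sub>v n"
  proof
    assume "vec n (\<lambda>k. u (F (k + 1))) = 0\<^sub>v n"
    then have "vec n (\<lambda>k. u (F (k + 1))) $ (i - 1) = 0\<^sub>v n $ (i - 1)" by simp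
    with u(2,3) show False by (cases i) auto
  qed
  ultimately show False
    using assms det_0_iff_vec_prod_zero[OF spline_matrix_carrier] by (metis vec_carrier)
qed

section \<open>Cramer's rule\<close>

lemma adj_mat_mult_vec_index:
  assumes A: "A \<in> carrier_mat n n" and "b \<in> carrier_vec n" "k < n"
  shows "(adj_mat A *\<^sub>v b) $ k = det (replace_col A b k)"
proof -
  \<comment> \<open>Cofactors along column \<open>k\<close> ignore that column, so replacing it
    leaves them unchanged.\<close>
  have "cofactor (replace_col A b k) r k = cofactor A r k" if "r < n" for r
  proof -
    have "mat_delete (replace_col A b k) r k = mat_delete A r k"
      using A that assms(3) by (intro eq_matI) (auto simp: mat_delete_def replace_col_def)
    then show ?thesis by (simp add: cofactor_def)
  qed
  moreover have "replace_col A b k \<in> carrier_mat n n" using A by (simp add: replace_col_def)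
  ultimately show ?thesis
    using A assms(2,3)
    by (subst laplace_expansion_column[of _ n k])
       (auto simp: replace_col_def adj_mat_def scalar_prod_def lessThan_atLeast0 mult.commute intro!: sum.cong)
qed

text \<open>The adjugate applied to \<open>b\<close> has all entries divisible by
  \<open>det A\<close>; applying \<open>A\<close> to the quotient and cancelling
  \<open>det A\<close> yields \<open>b\<close>.\<close>

lemma cramer_dvd:
  fixes A :: "'a::idom mat"
  assumes A: "A \<in> carrier_mat n n" and b: "b \<in> carrier_vec n" and "det A \<noteq> 0"
    and dvd: "\<And>k. k < n \<Longrightarrow> det A dvd det (replace_col A b k)"
  obtains c where "c \<in> carrier_vec n" "A *\<^sub>v c = b"
proof -
  define y where "y = adj_mat A *\<^sub>v b"
  have adj: "adj_mat A \<in> carrier_mat n n" by (rule adj_mat(1)[OF A])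
  have "\<forall>k<n. \<exists>z. y $ k = det A * z"
    using dvd adj_mat_mult_vec_index[OF A b] by (auto simp: y_def dvd_def)
  then obtain z where z: "\<And>k. k < n \<Longrightarrow> y $ k = det A * z k" by metis
  have y: "y = det A \<cdot>\<^sub>v vec n z"
    using adj b z by (intro eq_vecI) (auto simp: y_def)
  have "det A \<cdot>\<^sub>v (A *\<^sub>v vec n z) = A *\<^sub>v y"
    using A unfolding y by (intro eq_vecI) auto
  also have "\<dots> = (A * adj_mat A) *\<^sub>v b"
    using A adj b by (simp add: y_def assoc_mult_mat_vec)
  also have "\<dots> = det A \<cdot>\<^sub>v (1\<^sub>m n *\<^sub>v b)"
    unfolding adj_mat(2)[OF A] using b by auto
  also have "\<dots> = det A \<cdot>\<^sub>v b"
    using b by simp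
  finally have *: "(det A \<cdot>\<^sub>v (A *\<^sub>v vec n z)) $ k = (det A \<cdot>\<^sub>v b) $ k" for k by simp
  have "A *\<^sub>v vec n z = b"
  proof (rule eq_vecI)
    fix k assume "k < dim_vec b"
    with *[of k] A b \<open>det A \<noteq> 0\<close> show "(A *\<^sub>v vec n z) $ k = b $ k" by auto
  qed (use A b in auto)
  then show ?thesis using that[of "vec n z"] by simp
qed

lemma prod_reflect: "(\<Prod>r<n. f (n - r)) = (\<Prod>i\<in>{1..n}. f i)" for n :: nat
  by (rule prod.reindex_bij_witness[of _ "\<lambda>i. n - i" "\<lambda>r. n - r"]) auto

section \<open>Local comparison of \<open>Q_graph\<close> with determinants\<close>

context total_localization
begin

text \<open>In \<open>U * spline_matrix n G = T * B\<close> the triangular \<open>U\<close> performs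
  the row operations and has denominators on its diagonal, while the diagonal \<open>T\<close> has
  determinant \<open>Q_graph n E l\<close>.\<close>

lemma Q_graph_local_dvd_det:
  assumes lab: "edge_labeling E \<alpha> l" and E: "finite E" "\<forall>e\<in>E. finite e"
    and G: "G ` {1..n} \<subseteq> splines n E \<alpha>"
  shows "Q_graph n E l \<preceq> det (spline_matrix n G)"
proof -
  have "\<forall>i\<in>{1..n}. \<exists>s j. s \<in> S \<and> j < i \<and>
      (\<forall>H. H \<in> splines n E \<alpha> \<longrightarrow> trail_lcm E l i dvd s * (H i - H j))"
  proof
    fix i assume "i \<in> {1..n}"
    then have "i > 0" by simp
    from spline_diff_local_dvd[OF lab E this, of n]
    show "\<exists>s j. s \<in> S \<and> j < i \<and> (\<forall>H. H \<in> splines n E \<alpha> \<longrightarrow> trail_lcm E l i dvd s * (H i - H j))"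
      by metis
  qed
  then obtain s j where sj: "\<forall>i\<in>{1..n}. s i \<in> S \<and> j i < i \<and>
      (\<forall>H. H \<in> splines n E \<alpha> \<longrightarrow> trail_lcm E l i dvd s i * (H i - H (j i)))"
    unfolding bchoice_iff by blast
  \<comment> \<open>If \<open>j i = 0\<close>, the second term hits no column, in accordance with \<open>G k 0 = 0\<close>.\<close>
  define U where "U = mat n n (\<lambda>(r, c).
    (if c = r then s (n - r) else 0) + (if c = n - j (n - r) then - s (n - r) else 0))"
  have outside: "G (k + 1) 0 = 0" if "k < n" for k
  proof -
    have "G (k + 1) \<in> splines n E \<alpha>" using G that by auto
    then show ?thesis by (simp add: splines_def)
  qed
  have UG: "(U * spline_matrix n G) $$ (r, k) =
      s (n - r) * (G (k + 1) (n - r) - G (k + 1) (j (n - r)))" if "r < n" "k < n" for r k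
  proof -
    have "j (n - r) < n - r" using sj that by auto
    have "(U * spline_matrix n G) $$ (r, k) =
        (\<Sum>c<n. (if c = r then s (n - r) * G (k + 1) (n - r) else 0)
           + (if c = n - j (n - r) then - s (n - r) * G (k + 1) (j (n - r)) else 0))"
      using that \<open>j (n - r) < n - r\<close>
      by (auto simp: U_def spline_matrix_def scalar_prod_def lessThan_atLeast0 distrib_right intro!: sum.cong)
    also have "\<dots> = s (n - r) * (G (k + 1) (n - r) - G (k + 1) (j (n - r)))"
      using that \<open>j (n - r) < n - r\<close> outside[OF that(2)]
      by (cases "j (n - r) = 0") (auto simp: sum.distrib right_diff_distrib)
    finally show ?thesis .
  qed
  have "\<forall>i\<in>{1..n}. \<forall>k\<in>{1..n}. \<exists>b. s i * (G k i - G k (j i)) = trail_lcm E l i * b"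
    using sj G by (fastforce simp: dvd_def)
  then obtain b where b: "\<And>i k. i \<in> {1..n} \<Longrightarrow> k \<in> {1..n} \<Longrightarrow>
      s i * (G k i - G k (j i)) = trail_lcm E l i * b i k"
    by metis
  define B where "B = mat n n (\<lambda>(r, k). b (n - r) (k + 1))"
  define T where "T = mat n n (\<lambda>(r, c). if c = r then trail_lcm E l (n - r) else 0)"
  have "U * spline_matrix n G = T * B"
  proof (rule eq_matI)
    fix r k assume "r < dim_row (T * B)" "k < dim_col (T * B)"
    then have rk: "r < n" "k < n" by (auto simp: T_def B_def)
    have "(T * B) $$ (r, k) = trail_lcm E l (n - r) * b (n - r) (k + 1)"
      using rk by (simp add: T_def B_def scalar_prod_def if_distrib[of "\<lambda>x. x * _"] cong: if_cong)
    then show "(U * spline_matrix n G) $$ (r, k) = (T * B) $$ (r, k)"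
      using rk UG[OF rk] b[of "n - r" "k + 1"] by simp
  qed (auto simp: U_def T_def B_def spline_matrix_def)
  moreover have "U \<in> carrier_mat n n" "T \<in> carrier_mat n n" "B \<in> carrier_mat n n"
    by (simp_all add: U_def T_def B_def)
  ultimately have "det U * det (spline_matrix n G) = det T * det B"
    using det_mult[of U n "spline_matrix n G"] det_mult[of T n B] by simp
  moreover have "det U = prod s {1..n}"
  proof -
    \<comment> \<open>Row \<open>r\<close> belongs to vertex \<open>n - r\<close>; as
      \<open>j (n - r) < n - r\<close>, its second entry, if it lies in the matrix, is right of the
      diagonal.\<close>
    have "upper_triangular U"
    proof (rule upper_triangularI)
      fix c r assume "c < r" "r < dim_row U"
      moreover from this have "j (n - r) < n - r" using sj by (auto simp: U_def)
      ultimately show "U $$ (r, c) = 0" by (auto simp: U_def)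
    qed
    then have "det U = (\<Prod>r<n. U $$ (r, r))"
      by (subst det_upper_triangular[of _ n]) (auto simp: U_def prod_list_diag_prod lessThan_atLeast0)
    also have "\<dots> = (\<Prod>r<n. s (n - r))"
    proof (rule prod.cong)
      fix r assume "r \<in> {..<n}"
      moreover from this have "j (n - r) < n - r" using sj by auto
      ultimately show "U $$ (r, r) = s (n - r)" by (auto simp: U_def)
    qed simp
    finally show ?thesis by (simp add: prod_reflect)
  qed
  moreover have "det T = Q_graph n E l"
    unfolding Q_graph_def prod_reflect[symmetric]
    by (subst det_upper_triangular[of _ n]) (auto simp: T_def prod_list_diag_prod lessThan_atLeast0)
  moreover have "prod s {1..n} \<in> S" using sj by (intro prod_mem) auto
  ultimately show ?thesis unfolding local_dvd_def by (metis dvd_triv_left)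
qed

lemma flow_up_splines_det:
  assumes lab: "edge_labeling E \<alpha> l" and E: "finite E" "\<And>e. e \<in> E \<Longrightarrow> e \<subseteq> {1..n}"
  obtains G where "G ` {1..n} \<subseteq> splines n E \<alpha>" "det (spline_matrix n G) \<preceq> Q_graph n E l"
proof -
  have "\<forall>i\<in>{1..n}. \<exists>G s. s \<in> S \<and> G \<in> splines n E \<alpha> \<and> G i = s * trail_lcm E l i \<and> (\<forall>j<i. G j = 0)"
    using flow_up_spline[OF lab E] by metis
  then obtain H s where H: "\<And>i. i \<in> {1..n} \<Longrightarrow> s i \<in> S \<and> H i \<in> splines n E \<alpha> \<and>
      H i i = s i * trail_lcm E l i \<and> (\<forall>j<i. H i j = 0)"
    by metis
  \<comment> \<open>Reversing the order of the columns makes the matrix upper triangular.\<close>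
  define G where "G k = H (n + 1 - k)" for k
  have "upper_triangular (spline_matrix n G)"
    using H by (auto simp: spline_matrix_def G_def)
  then have "det (spline_matrix n G) = (\<Prod>r<n. H (n - r) (n - r))"
    by (subst det_upper_triangular[of _ n])
       (auto simp: spline_matrix_def prod_list_diag_prod lessThan_atLeast0 G_def)
  also have "\<dots> = prod s {1..n} * Q_graph n E l"
    unfolding prod_reflect[of "\<lambda>i. H i i"] Q_graph_def using H by (simp add: prod.distrib)
  finally have "det (spline_matrix n G) \<preceq> Q_graph n E l"
    unfolding local_dvd_def using H prod_mem[of "{1..n}" s] by auto
  moreover have "G k \<in> splines n E \<alpha>" if "k \<in> {1..n}" for k
  proof -
    have "n + 1 - k \<in> {1..n}" using that by auto
    then show ?thesis using H by (simp add: G_def)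
  qed
  ultimately show ?thesis by (intro that[of G]) auto
qed

end

text \<open>Makes \<open>Q_graph\<close> cancellable. A zero trail ends away from its start, so it
  has an edge, and its gcd involves a nonzero label.\<close>

lemma trail_lcm_nonzero:
  assumes "finite E" "\<forall>e\<in>E. finite e" "\<forall>e\<in>E. l e \<noteq> 0"
  shows "trail_lcm E l i \<noteq> (0 :: 'a::ring_gcd)"
proof -
  have "trail_gcd l p \<noteq> 0" if "p \<in> zero_trails E i" for p
  proof -
    have "trail_edges p \<noteq> []" using that by (cases p rule: remdups_adj.cases) (auto simp: zero_trails_def trail_def)
    then obtain e where "e \<in> set (trail_edges p)" by (cases "trail_edges p") auto
    moreover from this have "l e \<noteq> 0" using that assms(3) by (auto simp: zero_trails_def trail_def)
    ultimately show ?thesis by (auto simp: trail_gcd_def Gcd_fin_0_iff)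
  qed
  then show ?thesis using finite_zero_trails[OF assms(1,2)] by (auto simp: trail_lcm_def Lcm_fin_0_iff)
qed

theorem theorem4p12:
  fixes n :: nat
    and \<alpha> :: "nat set \<Rightarrow> 'a::{idom, ring_gcd} set"
    and l :: "nat set \<Rightarrow> 'a"
    and F :: "nat \<Rightarrow> nat \<Rightarrow> 'a"
  assumes labeling: "edge_labeling (complete_edges n) \<alpha> l"
    and nonzero: "\<forall>e\<in>complete_edges n. l e \<noteq> 0"
    and F: "F ` {1..n} \<subseteq> splines n (complete_edges n) \<alpha>"
  shows "module_basis (F ` {1..n}) (splines n (complete_edges n) \<alpha>) \<longleftrightarrow>
    (\<exists>r. r dvd 1 \<and> det (spline_matrix n F) = r * Q_graph n (complete_edges n) l)"
proof -
  let ?E = "complete_edges n"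
  let ?M = "splines n ?E \<alpha>" and ?Q = "Q_graph n ?E l" and ?A = "spline_matrix n F"
  note fin = finite_complete_edges[of n]
  have Q_nonzero: "?Q \<noteq> 0"
    using trail_lcm_nonzero[OF fin nonzero] by (simp add: Q_graph_def)
  have Q_dvd: "?Q dvd det (spline_matrix n G)" if "G ` {1..n} \<subseteq> ?M" for G
    by (rule dvd_if_locally_dvd) (rule total_localization.Q_graph_local_dvd_det[OF _ labeling fin that])
  show ?thesis
  proof
    assume basis: "module_basis (F ` {1..n}) ?M"
    have "det ?A dvd ?Q"
    proof (rule dvd_if_locally_dvd)
      fix S :: "'a set" assume "total_localization S"
      then interpret total_localization S .
      \<comment> \<open>The family \<open>G\<close> depends on the localization, but its expansion
        in the basis holds in the ring itself, so \<open>det ?A\<close> divides its determinant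
        globally.\<close>
      obtain G where G: "G ` {1..n} \<subseteq> ?M" "local_dvd (det (spline_matrix n G)) ?Q"
        by (rule flow_up_splines_det[OF labeling fin(1)]) (auto simp: complete_edges_def)
      have "\<forall>k\<in>{1..n}. \<exists>c. G k = (\<Sum>i\<in>{1..n}. fun_scale (c i) (F i))"
        using G(1) basis span_image_iff[of "{1..n}" _ F] by (auto simp: module_basis_def)
      then obtain c where c: "\<And>k. k \<in> {1..n} \<Longrightarrow> G k = (\<Sum>i\<in>{1..n}. fun_scale (c k i) (F i))"
        by metis
      have "spline_matrix n G = ?A * mat n n (\<lambda>(i, k). c (k + 1) (i + 1))"
        unfolding spline_matrix_mult unfolding spline_matrix_def by (rule eq_matI) (auto simp: c)
      then have "det ?A dvd det (spline_matrix n G)"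
        by (simp add: det_mult[OF spline_matrix_carrier mat_carrier])
      with G(2) show "local_dvd (det ?A) ?Q" by (blast intro: local_dvd_trans dvd_imp_local_dvd)
    qed
    then obtain t where t: "?Q = det ?A * t" by (rule dvdE)
    obtain r where r: "det ?A = ?Q * r" using Q_dvd[OF F] by (rule dvdE)
    have "?Q * (r * t) = det ?A * t" by (simp add: r mult.assoc)
    also have "\<dots> = ?Q * 1" using t by simp
    finally have "?Q * (r * t) = ?Q * 1" .
    with Q_nonzero have "r * t = 1" by simp
    then have "r dvd 1" by (metis dvd_triv_left)
    with r show "\<exists>r. r dvd 1 \<and> det ?A = r * ?Q" by (auto simp: mult.commute)
  next
    assume "\<exists>r. r dvd 1 \<and> det ?A = r * ?Q"
    then obtain r where r: "r dvd 1" "det ?A = r * ?Q" by blast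
    then have det_nonzero: "det ?A \<noteq> 0" using Q_nonzero by auto
    have det_dvd: "det ?A dvd det (spline_matrix n G)" if "G ` {1..n} \<subseteq> ?M" for G
      using Q_dvd[OF that] r by simp
    have "x \<in> fun_module.span (F ` {1..n})" if x: "x \<in> ?M" for x
    proof -
      \<comment> \<open>Replacing a column by the values of \<open>x\<close> gives the matrix of
        another family of splines, as Cramer's rule requires.\<close>
      have "det ?A dvd det (replace_col ?A (vec n (\<lambda>r. x (n - r))) k)" if "k < n" for k
      proof -
        have "replace_col ?A (vec n (\<lambda>r. x (n - r))) k = spline_matrix n (F(k + 1 := x))"
          by (rule eq_matI) (auto simp: replace_col_def spline_matrix_def)
        moreover have "F(k + 1 := x) ` {1..n} \<subseteq> ?M" using F x by auto
        ultimately show ?thesis using det_dvd by metis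
      qed
      then obtain c where c: "c \<in> carrier_vec n" "?A *\<^sub>v c = vec n (\<lambda>r. x (n - r))"
        using cramer_dvd[OF spline_matrix_carrier _ det_nonzero] vec_carrier by metis
      define y where "y = (\<Sum>i\<in>{1..n}. fun_scale (c $ (i - 1)) (F i))"
      have "c = vec n (\<lambda>k. c $ (k + 1 - 1))" using c(1) by auto
      with c(2) have eq: "vec n (\<lambda>r. x (n - r)) = vec n (\<lambda>r. y (n - r))"
        using spline_matrix_mult_vec[of n F "\<lambda>i. c $ (i - 1)"] by (simp add: y_def)
      \<comment> \<open>The vectors record only values at vertices; elsewhere both functions
        vanish.\<close>
      have "x v = y v" for v
      proof (cases "v \<in> {1..n}")
        case True
        with arg_cong[OF eq, of "\<lambda>w. w $ (n - v)"] show ?thesis by simp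
      next
        case False
        have "F i v = 0" if "i \<in> {1..n}" for i
        proof -
          have "F i \<in> ?M" using F that by auto
          with False show ?thesis by (simp add: splines_def)
        qed
        moreover have "x v = 0" using False x by (simp add: splines_def)
        ultimately show ?thesis by (simp add: y_def sum_fun_scale_apply)
      qed
      then have "x = y" by (rule ext)
      then show ?thesis by (auto simp: span_image_iff y_def)
    qed
    moreover have "fun_module.span (F ` {1..n}) \<subseteq> ?M"
      by (rule fun_module.span_minimal[OF F subspace_splines[OF labeling]])
    ultimately show "module_basis (F ` {1..n}) ?M"
      using F independent_if_det_nonzero[OF det_nonzero] by (auto simp: module_basis_def)
  qed
qed

end
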